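(* Entropy-regularized $N$-stage games have a value. That is, for every $N\in\{1,2,\dots\}$, all $\beta_1,\beta_2>0$ and every initial distribution $\mu_1\in\Delta(\mathcal{X})$, $$\max_{\boldsymbol{\sigma}\in\Gamma_1}\ \min_{\boldsymbol{\tau}\in\Gamma_2}\Phi_N(\boldsymbol{\sigma},\boldsymbol{\tau})=\min_{\boldsymbol{\tau}\in\Gamma_2}\ \max_{\boldsymbol{\sigma}\in\Gamma_1}\Phi_N(\boldsymbol{\sigma},\boldsymbol{\tau}).$$
   Context: **Game.** $\mathcal{X}$ (states), $\mathcal{U}$ (actions of player 1), $\mathcal{W}$ (actions of player 2) are finite nonempty sets; $\Delta(S)$ is the probability simplex over a finite set $S$. The transition kernel is $\mathcal{P}:\mathcal{X}\times\mathcal{U}\times\mathcal{W}\to\Delta(\mathcal{X})$, written $\mathcal{P}(x'|x,u,w)$. The stage payoff (made by player 2 to player 1) is a real-valued function $\mathcal{R}(x,u,w)$, and there is a real-valued terminal payoff, also denoted $\mathcal{R}(x)$, $x\in\mathcal{X}$. At each stage $t$ both players observe the current state and simultaneously choose actions $u_t,w_t$; the next state is drawn from $\mathcal{P}(\cdot|x_t,u_t,w_t)$. Player 1 maximizes and player 2 minimizes the evaluation function. **Strategies.** For a sequence, $x^t=(x_1,\dots,x_t)$. The set of histories up to stage $t$ is $\mathcal{H}_t=(\mathcal{X}\times\mathcal{U}\times\mathcal{W})^{t-1}\times\mathcal{X}$, with elements $h_t=(x^t,u^{t-1},w^{t-1})$. A strategy of player 1 is $\boldsymbol{\sigma}=(\sigma_1,\sigma_2,\dots)$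 with $\sigma_t:\mathcal{H}_t\to\Delta(\mathcal{U})$; a strategy of player 2 is $\boldsymbol{\tau}=(\tau_1,\tau_2,\dots)$ with $\tau_t:\mathcal{H}_t\to\Delta(\mathcal{W})$ (in an $N$-stage game only $t=1,\dots,N$ matter). $\Gamma_i$ denotes the set of all strategies of player $i\in\{1,2\}$. **Induced distribution.** Given $\mu_1\in\Delta(\mathcal{X})$ and $(\boldsymbol{\sigma},\boldsymbol{\tau})$, the distribution of histories is defined by $\mu_{t+1}(x^{t+1},u^t,w^t)=\mathcal{P}(x_{t+1}|x_t,u_t,w_t)\,\sigma_t(u_t|h_t)\,\tau_t(w_t|h_t)\,\mu_t(h_t)$. All random variables $X_t,U_t,W_t$ below have this joint law; $\mathbb{E}$ denotes the corresponding expectation. **Evaluation function.** With natural logarithms, $0\log 0=0$, and $H(\cdot|\cdot)$ the conditional Shannon entropy, $$\Phi_N(\boldsymbol{\sigma},\boldsymbol{\tau})=\sum_{t=1}^N\mathbb{E}\,\mathcal{R}(X_t,U_t,W_t)+\mathbb{E}\,\mathcal{R}(X_{N+1})+\frac1{\beta_1}\sum_{t=1}^N H(U_t|X^t,U^{t-1},W^{t-1})-\frac1{\beta_2}\sum_{t=1}^N H(W_t|X^t,U^{t-1},W^{t-1}).$$ (The two sums of entropies are the causal entropies $H(U^N\|X^N,W^{N-1})$ and $H(W^N\|X^N,U^{N-1})$.) *)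

theory Defs
  imports "HOL-Probability.Probability"
begin

text \<open>
  The states, the actions of player 1 and the actions of player 2 are the elements of types
  \<open>'x\<close>, \<open>'u\<close>, \<open>'w\<close> of class \<open>finite\<close>.  A pair \<open>(l, x)\<close> stands for the history
  \<open>h\<^sub>t\<close> with \<open>t = length l + 1\<close>: the list holds the triples \<open>(x\<^sub>s, u\<^sub>s, w\<^sub>s)\<close> for
  \<open>s = 1, \<dots>, t - 1\<close> in chronological order, and \<open>x\<close> is the current state \<open>x\<^sub>t\<close>.
  The type is thus the disjoint union of all the sets \<open>H\<^sub>t\<close>, and a function on it is the same
  as a sequence of functions, the one with index \<open>t\<close> being defined on \<open>H\<^sub>t\<close>.
\<close>

type_synonym ('x, 'u, 'w) hist = "('x \<times> 'u \<times> 'w) list \<times> 'x"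

type_synonym ('x, 'u, 'w) strategy1 = "('x, 'u, 'w) hist \<Rightarrow> 'u pmf"

type_synonym ('x, 'u, 'w) strategy2 = "('x, 'u, 'w) hist \<Rightarrow> 'w pmf"

text \<open>
  \<open>hist_law P \<mu> \<sigma> \<tau> n\<close> is the law of the history after \<open>n\<close> completed stages, i.e.
  \<open>\<mu>\<^bsub>n+1\<^esub>\<close> on \<open>H\<^bsub>n+1\<^esub>\<close>.
\<close>

primrec hist_law ::
  "('x::finite \<Rightarrow> 'u::finite \<Rightarrow> 'w::finite \<Rightarrow> 'x pmf) \<Rightarrow> 'x pmf \<Rightarrow>
   ('x, 'u, 'w) strategy1 \<Rightarrow> ('x, 'u, 'w) strategy2 \<Rightarrow> nat \<Rightarrow> ('x, 'u, 'w) hist pmf" where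
  "hist_law P \<mu> \<sigma> \<tau> 0 = map_pmf (\<lambda>x. ([], x)) \<mu>"
| "hist_law P \<mu> \<sigma> \<tau> (Suc n) =
     bind_pmf (hist_law P \<mu> \<sigma> \<tau> n) (\<lambda>h.
     bind_pmf (\<sigma> h) (\<lambda>u.
     bind_pmf (\<tau> h) (\<lambda>w.
     map_pmf (\<lambda>x'. (fst h @ [(snd h, u, w)], x')) (P (snd h) u w))))"

text \<open>The recursive formula for the masses \<open>\<mu>\<^bsub>t+1\<^esub>\<close>:\<close>

lemma hist_law_pmf:
  "pmf (hist_law P \<mu> \<sigma> \<tau> (Suc n)) (l @ [(x, u, w)], x') =
     pmf (P x u w) x' * pmf (\<sigma> (l, x)) u * pmf (\<tau> (l, x)) w * pmf (hist_law P \<mu> \<sigma> \<tau> n) (l, x)"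
proof -
  have m: "pmf (map_pmf (\<lambda>x'. (fst h @ [(snd h, u2, w2)], x')) q) (l @ [(x, u, w)], x')
     = indicator {(l,x)} h * (indicator {u} u2 * (indicator {w} w2 * pmf q x'))" for h u2 w2 q
  proof (cases "h = (l,x) \<and> u2 = u \<and> w2 = w")
    case True
    then show ?thesis by (simp add: pmf_map_inj'[of "\<lambda>x'. (l @ [(x, u, w)], x')" q x', simplified inj_on_def, simplified])
  next
    case False
    then show ?thesis by (auto simp: pmf_eq_0_set_pmf indicator_def)
  qed
  have e: "measure_pmf.expectation q (\<lambda>y. indicator {z} y * f y) = pmf q z * f z"
    for q :: "'d pmf" and z and f :: "'d \<Rightarrow> real"
    by (subst integral_measure_pmf_real[where A = "{z}"]) (auto simp: indicator_def)
  show ?thesis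
    by (simp only: hist_law.simps pmf_bind m e integral_mult_right_zero) simp
qed

text \<open>
  Coordinates \<open>X\<^sub>t\<close>, \<open>U\<^sub>t\<close>, \<open>W\<^sub>t\<close> of a history \<open>h\<^bsub>n+1\<^esub>\<close>, and its restriction
  \<open>(X\<^sup>t, U\<^bsup>t-1\<^esup>, W\<^bsup>t-1\<^esup>)\<close> to the first stages.  Stages are numbered from 1; states and restrictions
  are meaningful for \<open>1 \<le> t \<le> n + 1\<close>, actions for \<open>1 \<le> t \<le> n\<close>.
\<close>

definition state_at :: "nat \<Rightarrow> ('x, 'u, 'w) hist \<Rightarrow> 'x" where
  "state_at t h = (if t \<le> length (fst h) then fst (fst h ! (t - 1)) else snd h)"

definition action1_at :: "nat \<Rightarrow> ('x, 'u, 'w) hist \<Rightarrow> 'u" where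
  "action1_at t h = fst (snd (fst h ! (t - 1)))"

definition action2_at :: "nat \<Rightarrow> ('x, 'u, 'w) hist \<Rightarrow> 'w" where
  "action2_at t h = snd (snd (fst h ! (t - 1)))"

definition hist_at :: "nat \<Rightarrow> ('x, 'u, 'w) hist \<Rightarrow> ('x, 'u, 'w) hist" where
  "hist_at t h = (take (t - 1) (fst h), state_at t h)"

text \<open>Conditional Shannon entropy of \<open>A\<close> given \<open>B\<close> under the law \<open>p\<close>, in natural logarithms.\<close>

abbreviation cond_entropy_pmf :: "'a pmf \<Rightarrow> ('a \<Rightarrow> 'b) \<Rightarrow> ('a \<Rightarrow> 'c) \<Rightarrow> real" where
  "cond_entropy_pmf p A B \<equiv>
     prob_space.conditional_entropy (measure_pmf p) (exp 1) (count_space UNIV) (count_space UNIV) A B"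

text \<open>
  On countable types the measure-theoretic definition is the elementary one; the expectation only
  ranges over the support, which accounts for \<open>0 log 0 = 0\<close>.
\<close>

lemma cond_entropy_pmf_eq:
  fixes A :: "'a \<Rightarrow> 'b::countable" and B :: "'a \<Rightarrow> 'c::countable"
  shows "cond_entropy_pmf p A B =
    - measure_pmf.expectation (map_pmf (\<lambda>\<omega>. (A \<omega>, B \<omega>)) p)
      (\<lambda>(a, b). ln (pmf (map_pmf (\<lambda>\<omega>. (A \<omega>, B \<omega>)) p) (a, b) / pmf (map_pmf B p) b))"
proof -
  have E: "count_space (UNIV::'b set) \<Otimes>\<^sub>M count_space (UNIV::'c set) = count_space UNIV"
    by (subst pair_measure_countable) (auto)
  have distr: "distr (measure_pmf p) (count_space UNIV) f = density (count_space UNIV) (\<lambda>x. ennreal (pmf (map_pmf f p) x))"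
    for f :: "'a \<Rightarrow> 'd"
    using measure_pmf_eq_density[of "map_pmf f p"] by (simp only: map_pmf_rep_eq)
  have RN: "enn2real (RN_deriv (count_space UNIV) (distr (measure_pmf p) (count_space UNIV) f) y) = pmf (map_pmf f p) y"
    for f :: "'a \<Rightarrow> 'd::countable" and y
  proof -
    have "AE x in count_space UNIV. ennreal (pmf (map_pmf f p) x) = RN_deriv (count_space UNIV) (distr (measure_pmf p) (count_space UNIV) f) x"
      unfolding distr
      by (rule sigma_finite_measure.RN_deriv_unique)
        (auto simp: sigma_finite_measure_count_space)
    then show ?thesis by (simp add: AE_count_space) (metis enn2real_ennreal pmf_nonneg)
  qed
  have lo: "log (exp 1) z = ln z" for z :: real by (simp add: log_def)
  show ?thesis
    unfolding prob_space.conditional_entropy_def[OF prob_space_measure_pmf] E RN lo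
    by (simp add: map_pmf_rep_eq[symmetric])
qed

text \<open>\<open>R\<close> is the stage payoff, \<open>G\<close> the terminal payoff.\<close>

definition evaluation ::
  "('x::finite \<Rightarrow> 'u::finite \<Rightarrow> 'w::finite \<Rightarrow> 'x pmf) \<Rightarrow> ('x \<Rightarrow> 'u \<Rightarrow> 'w \<Rightarrow> real) \<Rightarrow> ('x \<Rightarrow> real) \<Rightarrow>
   real \<Rightarrow> real \<Rightarrow> 'x pmf \<Rightarrow> nat \<Rightarrow>
   ('x, 'u, 'w) strategy1 \<Rightarrow> ('x, 'u, 'w) strategy2 \<Rightarrow> real" where
  "evaluation P R G \<beta>1 \<beta>2 \<mu> N \<sigma> \<tau> =
     (let p = hist_law P \<mu> \<sigma> \<tau> N in
        (\<Sum>t = 1..N. measure_pmf.expectation p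
            (\<lambda>h. R (state_at t h) (action1_at t h) (action2_at t h)))
      + measure_pmf.expectation p (\<lambda>h. G (state_at (N + 1) h))
      + 1 / \<beta>1 * (\<Sum>t = 1..N. cond_entropy_pmf p (action1_at t) (hist_at t))
      - 1 / \<beta>2 * (\<Sum>t = 1..N. cond_entropy_pmf p (action2_at t) (hist_at t)))"

text \<open>The maximum of \<open>f\<close> over its whole type is attained and equals \<open>v\<close>; dually for the minimum.\<close>

definition is_maximum :: "('a \<Rightarrow> real) \<Rightarrow> real \<Rightarrow> bool" where
  "is_maximum f v \<longleftrightarrow> v \<in> range f \<and> (\<forall>a. f a \<le> v)"

definition is_minimum :: "('a \<Rightarrow> real) \<Rightarrow> real \<Rightarrow> bool" where
  "is_minimum f v \<longleftrightarrow> v \<in> range f \<and> (\<forall>a. v \<le> f a)"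

end

theory Submission
  imports Defs
begin

text \<open>
  The causal entropy of a player is a sum over stages of conditional entropies of the action given
  the history.  As a strategy is precisely the conditional law of the action given the history,
  each summand is the expected Shannon entropy of the distribution prescribed at that history
  (\<open>cond_entropy_kernel\<close>, \<open>evaluation_stagewise\<close>).  The evaluation is therefore the expected sum of stage payoffs of the
  form \<open>mixed_payoff\<close>: a bilinear term plus the entropy of player 1 over \<open>\<beta>1\<close> minus the entropy of
  player 2 over \<open>\<beta>2\<close>.  A payoff of this additive shape is amenable to dynamic programming.

  For a single stage with payoff matrix \<open>a\<close>, the Gibbs variational principle
  (\<open>gibbs_variational\<close>) says that the best reply to a mixed action is a softmax of the expected
  payoffs, negated for player 2.  Best replies are thus explicit continuous functions, and
  Brouwer's theorem applied to the composition of the two reply maps yields a pair of mutual best replies, i.e. a saddle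
  point (\<open>mutual_replies_exist\<close>).

  The stages are glued together by backward induction (\<open>backward_induction\<close>): at each history the
  stage matrix is the current payoff plus the expected continuation value \<open>V\<close> (\<open>lookahead\<close>), and
  some pair of mixed actions is chosen there.  Choosing mutual best replies gives a saddle point of
  the \<open>N\<close>-stage game; keeping the actions of one given player and choosing the best reply of the
  other gives an optimal reply to a given strategy, so that the inner minimum and maximum are
  attained.  That local optimality implies global optimality is read off the identity
  \<open>evaluation_telescope\<close>, which expresses the evaluation of arbitrary strategies as the expected
  initial value plus expected one-stage gains relative to \<open>V\<close>.  The existence of a saddle point then
  gives the equality of the two iterated extrema.
\<close>

section \<open>The Gibbs variational principle\<close>

definition shannon :: "'a::finite pmf \<Rightarrow> real" where
  "shannon p = - (\<Sum>x\<in>UNIV. pmf p x * ln (pmf p x))"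

definition softmax :: "real \<Rightarrow> ('a::finite \<Rightarrow> real) \<Rightarrow> 'a \<Rightarrow> real" where
  "softmax b c x = exp (b * c x) / (\<Sum>y\<in>UNIV. exp (b * c y))"

definition gibbs :: "real \<Rightarrow> ('a::finite \<Rightarrow> real) \<Rightarrow> 'a pmf" where
  "gibbs b c = embed_pmf (softmax b c)"

lemma sum_exp_pos: "(\<Sum>y\<in>UNIV. exp (c y)) > (0::real)" for c :: "'a::finite \<Rightarrow> real"
  by (rule sum_pos) auto

lemma softmax_pos: "softmax b c x > 0"
  unfolding softmax_def by (intro divide_pos_pos sum_exp_pos) simp

lemma sum_softmax: "(\<Sum>x\<in>UNIV. softmax b c x) = 1"
  using sum_exp_pos[of "\<lambda>y. b * c y"]
  by (simp add: softmax_def flip: sum_divide_distrib)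

lemma pmf_gibbs: "pmf (gibbs b c) x = softmax b c x"
  unfolding gibbs_def
proof (rule pmf_embed_pmf)
  show "(\<integral>\<^sup>+x. ennreal (softmax b c x) \<partial>count_space UNIV) = 1"
    by (subst nn_integral_count_space_finite)
       (auto simp: sum_ennreal less_imp_le[OF softmax_pos] sum_softmax)
qed (simp add: less_imp_le[OF softmax_pos])

lemma sum_pmf_UNIV: "(\<Sum>x\<in>UNIV. pmf p x) = 1" for p :: "'a::finite pmf"
  by (rule sum_pmf_eq_1) auto

text \<open>
  With \<open>L\<close> the logarithm of the partition function, \<open>b * c x = ln (softmax b c x) + L\<close>, so \<open>b\<close> times
  the objective is \<open>L\<close> minus the relative entropy of the distribution with respect to the Gibbs
  distribution.  Relative entropy is nonnegative because of \<open>ln z \<le> z - 1\<close>, and it vanishes at the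
  Gibbs distribution itself.
\<close>

lemma gibbs_variational:
  assumes "b > 0"
  shows "(\<Sum>x\<in>UNIV. pmf p x * c x) + shannon p / b
       \<le> (\<Sum>x\<in>UNIV. pmf (gibbs b c) x * c x) + shannon (gibbs b c) / b"
proof -
  define L where "L = ln (\<Sum>y\<in>UNIV. exp (b * c y))"
  have ln_softmax: "ln (softmax b c x) = b * c x - L" for x
    using sum_exp_pos[of "\<lambda>y. b * c y"] by (simp add: softmax_def L_def ln_div)
  have objective: "b * ((\<Sum>x\<in>UNIV. pmf q x * c x) + shannon q / b)
      = L + (\<Sum>x\<in>UNIV. pmf q x * (ln (softmax b c x) - ln (pmf q x)))" for q
  proof -
    have "L = (\<Sum>x\<in>UNIV. pmf q x * L)"
      by (simp add: sum_pmf_UNIV flip: sum_distrib_right)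
    then show ?thesis
      using assms
      by (simp add: shannon_def ln_softmax right_diff_distrib distrib_left sum_subtractf
          mult.left_commute flip: sum_distrib_left)
  qed
  have "pmf p x * (ln (softmax b c x) - ln (pmf p x)) \<le> softmax b c x - pmf p x" for x
  proof (cases "pmf p x = 0")
    case False
    then have p: "pmf p x > 0" by (simp add: pmf_pos)
    have "ln (softmax b c x) - ln (pmf p x) = ln (softmax b c x / pmf p x)"
      using p softmax_pos[of b c x] by (simp add: ln_div)
    also have "\<dots> \<le> softmax b c x / pmf p x - 1"
      using p softmax_pos by (intro ln_le_minus_one divide_pos_pos)
    finally have "pmf p x * (ln (softmax b c x) - ln (pmf p x)) \<le> pmf p x * (softmax b c x / pmf p x - 1)"
      using p by (intro mult_left_mono) auto
    also have "\<dots> = softmax b c x - pmf p x"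
      using p by (simp add: right_diff_distrib)
    finally show ?thesis .
  qed (simp add: less_imp_le[OF softmax_pos])
  then have "(\<Sum>x\<in>UNIV. pmf p x * (ln (softmax b c x) - ln (pmf p x)))
      \<le> (\<Sum>x\<in>UNIV. softmax b c x - pmf p x)"
    by (rule sum_mono)
  also have "\<dots> = 0" by (simp add: sum_subtractf sum_softmax sum_pmf_UNIV)
  finally have "b * ((\<Sum>x\<in>UNIV. pmf p x * c x) + shannon p / b)
      \<le> b * ((\<Sum>x\<in>UNIV. pmf (gibbs b c) x * c x) + shannon (gibbs b c) / b)"
    unfolding objective by (simp add: pmf_gibbs)
  then show ?thesis using assms by simp
qed

section \<open>Saddle points of entropy-regularized matrix games\<close>

definition mixed_payoff ::
  "real \<Rightarrow> real \<Rightarrow> ('u::finite \<Rightarrow> 'w::finite \<Rightarrow> real) \<Rightarrow> 'u pmf \<Rightarrow> 'w pmf \<Rightarrow> real" where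
  "mixed_payoff b1 b2 a p q =
     (\<Sum>u\<in>UNIV. \<Sum>w\<in>UNIV. pmf p u * pmf q w * a u w) + shannon p / b1 - shannon q / b2"

definition reply1 :: "real \<Rightarrow> ('u::finite \<Rightarrow> 'w::finite \<Rightarrow> real) \<Rightarrow> 'w pmf \<Rightarrow> 'u pmf" where
  "reply1 b1 a q = gibbs b1 (\<lambda>u. \<Sum>w\<in>UNIV. pmf q w * a u w)"

definition reply2 :: "real \<Rightarrow> ('u::finite \<Rightarrow> 'w::finite \<Rightarrow> real) \<Rightarrow> 'u pmf \<Rightarrow> 'w pmf" where
  "reply2 b2 a p = gibbs b2 (\<lambda>w. - (\<Sum>u\<in>UNIV. pmf p u * a u w))"

text \<open>
  For a fixed mixed action \<open>q\<close> of player 2 the payoff is, up to the constant entropy term of \<open>q\<close>,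
  a linear functional of \<open>p\<close> plus the scaled entropy of \<open>p\<close>, which the Gibbs distribution maximizes.
\<close>

lemma reply1_best:
  assumes "b1 > 0"
  shows "mixed_payoff b1 b2 a p q \<le> mixed_payoff b1 b2 a (reply1 b1 a q) q"
proof -
  have "mixed_payoff b1 b2 a p' q
      = (\<Sum>u\<in>UNIV. pmf p' u * (\<Sum>w\<in>UNIV. pmf q w * a u w)) + shannon p' / b1 - shannon q / b2" for p'
    by (simp add: mixed_payoff_def sum_distrib_left mult.assoc)
  then show ?thesis
    using gibbs_variational[OF assms] by (simp add: reply1_def)
qed

lemma reply2_best:
  assumes "b2 > 0"
  shows "mixed_payoff b1 b2 a p (reply2 b2 a p) \<le> mixed_payoff b1 b2 a p q"
proof -
  have "- mixed_payoff b1 b2 a p q'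
      = (\<Sum>w\<in>UNIV. pmf q' w * - (\<Sum>u\<in>UNIV. pmf p u * a u w)) + shannon q' / b2 - shannon p / b1" for q'
    unfolding mixed_payoff_def
    by (subst sum.swap) (simp add: sum_distrib_left sum_negf mult_ac)
  then show ?thesis
    using gibbs_variational[OF assms, of q "\<lambda>w. - (\<Sum>u\<in>UNIV. pmf p u * a u w)"]
    by (subst neg_le_iff_le[symmetric]) (simp only: reply2_def diff_right_mono)
qed

text \<open>
  A fixed point of the map sending \<open>p\<close> to the reply to the reply to \<open>p\<close> gives both distributions.
  The softmax formula makes sense for arbitrary weights, so the map extends to the whole unit cube of
  vectors indexed by the actions of player 1, and Brouwer's theorem is applied there; the fixed point
  is a probability vector because it is a value of softmax.
\<close>

lemma mutual_replies_exist:
  fixes a :: "'u::finite \<Rightarrow> 'w::finite \<Rightarrow> real"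
  obtains p q where "p = reply1 b1 a q" and "q = reply2 b2 a p"
proof -
  \<comment> \<open>\<open>B v\<close> is the reply of player 2 to the weights \<open>v\<close>, and \<open>F v\<close> the reply of player 1 to \<open>B v\<close>.\<close>
  define B where "B = (\<lambda>(v::real^'u) w. softmax b2 (\<lambda>w. - (\<Sum>u\<in>UNIV. v $ u * a u w)) w)"
  define F where "F = (\<lambda>v. \<chi> u. softmax b1 (\<lambda>u. \<Sum>w\<in>UNIV. B v w * a u w) u)"
  have "continuous_on (cbox 0 1) F"
    unfolding F_def B_def softmax_def
    by (intro continuous_intros)
       (auto intro!: continuous_intros simp: less_imp_neq[OF sum_exp_pos, symmetric])
  moreover have "F v \<in> cbox 0 1" for v
  proof -
    have "softmax b1 c u \<le> 1" for c :: "'u \<Rightarrow> real" and u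
      using member_le_sum[of u UNIV "softmax b1 c"]
      by (simp add: less_imp_le[OF softmax_pos] sum_softmax)
    then show ?thesis
      by (simp add: F_def mem_box_cart less_imp_le[OF softmax_pos])
  qed
  ultimately obtain v where v: "F v = v"
    using brouwer[of "cbox 0 (1::real^'u)" F] by (metis compact_cbox convex_box(1) empty_iff image_subsetI funcsetI)
  define q where "q = gibbs b2 (\<lambda>w. - (\<Sum>u\<in>UNIV. v $ u * a u w))"
  have q: "pmf q w = B v w" for w by (simp add: q_def B_def pmf_gibbs)
  have "pmf (reply1 b1 a q) u = F v $ u" for u
    by (simp add: reply1_def pmf_gibbs F_def q)
  then have "q = reply2 b2 a (reply1 b1 a q)"
    by (simp add: v reply2_def q_def)
  then show thesis using that by blast
qed

section \<open>The law of histories\<close>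

definition extend :: "('x, 'u, 'w) hist \<Rightarrow> 'u \<Rightarrow> 'w \<Rightarrow> 'x \<Rightarrow> ('x, 'u, 'w) hist" where
  "extend h u w x = (fst h @ [(snd h, u, w)], x)"

lemma length_extend [simp]: "length (fst (extend h u w x)) = Suc (length (fst h))"
  by (simp add: extend_def)

lemma hist_law_Suc:
  "hist_law P \<mu> \<sigma> \<tau> (Suc n) =
     bind_pmf (hist_law P \<mu> \<sigma> \<tau> n) (\<lambda>h. bind_pmf (\<sigma> h) (\<lambda>u. bind_pmf (\<tau> h) (\<lambda>w.
       map_pmf (extend h u w) (P (snd h) u w))))"
  by (simp add: extend_def[abs_def])

lemma finite_set_hist_law: "finite (set_pmf (hist_law P \<mu> \<sigma> \<tau> n))"
  by (induction n) auto

lemma length_hist_law: "h \<in> set_pmf (hist_law P \<mu> \<sigma> \<tau> n) \<Longrightarrow> length (fst h) = n"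
  by (induction n arbitrary: h) auto

lemma integrable_hist_law [simp]:
  "integrable (measure_pmf (hist_law P \<mu> \<sigma> \<tau> n)) (f :: _ \<Rightarrow> real)"
  by (rule integrable_measure_pmf_finite[OF finite_set_hist_law])

lemma expectation_bind_finite:
  fixes f :: "'b \<Rightarrow> real"
  assumes "finite (set_pmf p)" and "\<And>x. finite (set_pmf (k x))"
  shows "measure_pmf.expectation (bind_pmf p k) f
       = measure_pmf.expectation p (\<lambda>x. measure_pmf.expectation (k x) f)"
  by (subst pmf_expectation_bind[of "set_pmf p"]) 
     (use assms in \<open>auto simp: integral_measure_pmf[of "set_pmf p"]\<close>)

lemma expectation_UNIV:
  "measure_pmf.expectation p f = (\<Sum>x\<in>UNIV. pmf p x * f x)"
  for p :: "'a::finite pmf" and f :: "'a \<Rightarrow> real"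
  by (subst integral_measure_pmf[of UNIV]) auto

lemma expectation_hist_law_Suc:
  fixes f :: "_ \<Rightarrow> real"
  shows "measure_pmf.expectation (hist_law P \<mu> \<sigma> \<tau> (Suc n)) f
    = measure_pmf.expectation (hist_law P \<mu> \<sigma> \<tau> n) (\<lambda>h. \<Sum>u\<in>UNIV. \<Sum>w\<in>UNIV.
        pmf (\<sigma> h) u * pmf (\<tau> h) w * (\<Sum>x\<in>UNIV. pmf (P (snd h) u w) x * f (extend h u w x)))"
  unfolding hist_law_Suc
  by (simp add: expectation_bind_finite finite_set_hist_law expectation_UNIV sum_distrib_left
      mult.assoc)

text \<open>
  Statistics of the first stages are unaffected by what happens later; this replaces the law of
  complete plays by the law of shorter histories.
\<close>

lemma map_hist_law_stable:
  assumes "n \<le> N" and "\<And>h u w x. n \<le> length (fst h) \<Longrightarrow> g (extend h u w x) = g h"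
  shows "map_pmf g (hist_law P \<mu> \<sigma> \<tau> N) = map_pmf g (hist_law P \<mu> \<sigma> \<tau> n)"
  using assms(1)
proof (induction N rule: dec_induct)
  case (step m)
  have "map_pmf g (hist_law P \<mu> \<sigma> \<tau> (Suc m)) =
      bind_pmf (hist_law P \<mu> \<sigma> \<tau> m) (\<lambda>h. bind_pmf (\<sigma> h) (\<lambda>u. bind_pmf (\<tau> h) (\<lambda>w.
        map_pmf (\<lambda>x. g (extend h u w x)) (P (snd h) u w))))"
    unfolding hist_law_Suc by (simp add: map_bind_pmf pmf.map_comp o_def)
  also have "\<dots> = bind_pmf (hist_law P \<mu> \<sigma> \<tau> m) (\<lambda>h. return_pmf (g h))"
    using step.hyps
    by (intro bind_pmf_cong refl) (simp add: assms(2) length_hist_law)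
  also have "\<dots> = map_pmf g (hist_law P \<mu> \<sigma> \<tau> m)"
    by (simp add: map_pmf_def)
  finally show ?case using step.IH by simp
qed simp

lemma hist_at_extend:
  "n \<le> length (fst h) \<Longrightarrow> hist_at (Suc n) (extend h u w x) = hist_at (Suc n) h"
  by (auto simp: hist_at_def state_at_def extend_def nth_append)

lemma hist_at_full: "length (fst h) = n \<Longrightarrow> hist_at (Suc n) h = h"
  by (simp add: hist_at_def state_at_def)

lemma actions_at_extend:
  assumes "Suc n \<le> length (fst h)"
  shows "action1_at (Suc n) (extend h u w x) = action1_at (Suc n) h"
    and "action2_at (Suc n) (extend h u w x) = action2_at (Suc n) h"
  using assms by (auto simp: action1_at_def action2_at_def extend_def nth_append)

lemma actions_at_last:
  assumes "length (fst h) = n"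
  shows "action1_at (Suc n) (extend h u w x) = u"
    and "action2_at (Suc n) (extend h u w x) = w"
  using assms by (auto simp: action1_at_def action2_at_def extend_def nth_append)

text \<open>
  The stage with index \<open>n\<close> is the one numbered \<open>Suc n\<close>: it is preceded by \<open>n\<close> completed stages.  Given the
  history, the two actions are independent with the distributions prescribed by the strategies.
\<close>

lemma law_stage:
  assumes "n < N"
  shows "map_pmf (\<lambda>h. (action1_at (Suc n) h, action2_at (Suc n) h, hist_at (Suc n) h)) (hist_law P \<mu> \<sigma> \<tau> N)
    = bind_pmf (hist_law P \<mu> \<sigma> \<tau> n) (\<lambda>h. bind_pmf (\<sigma> h) (\<lambda>u. map_pmf (\<lambda>w. (u, w, h)) (\<tau> h)))"
    (is "map_pmf ?g _ = _")
proof -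
  have "map_pmf ?g (hist_law P \<mu> \<sigma> \<tau> N) = map_pmf ?g (hist_law P \<mu> \<sigma> \<tau> (Suc n))"
    using assms by (intro map_hist_law_stable) (auto simp: hist_at_extend actions_at_extend)
  also have "\<dots> = bind_pmf (hist_law P \<mu> \<sigma> \<tau> n) (\<lambda>h. bind_pmf (\<sigma> h) (\<lambda>u. bind_pmf (\<tau> h) (\<lambda>w.
        map_pmf (\<lambda>x. ?g (extend h u w x)) (P (snd h) u w))))"
    unfolding hist_law_Suc by (simp add: map_bind_pmf pmf.map_comp o_def)
  also have "\<dots> = bind_pmf (hist_law P \<mu> \<sigma> \<tau> n) (\<lambda>h. bind_pmf (\<sigma> h) (\<lambda>u. bind_pmf (\<tau> h) (\<lambda>w.
        return_pmf (u, w, h))))"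
    by (intro bind_pmf_cong refl)
       (simp add: length_hist_law hist_at_extend hist_at_full actions_at_last)
  finally show ?thesis by (simp add: map_pmf_def)
qed

section \<open>The evaluation as a sum of stage payoffs\<close>

text \<open>
  If \<open>k b\<close> is the conditional distribution of \<open>A\<close> given \<open>B = b\<close>, then the joint mass divided by the
  mass of \<open>b\<close> is \<open>pmf (k b) a\<close>, and averaging minus its logarithm over \<open>a\<close> leaves the entropy of \<open>k b\<close>.
\<close>

lemma cond_entropy_kernel:
  fixes A :: "'a \<Rightarrow> 'b::finite" and B :: "'a \<Rightarrow> 'c::countable"
  assumes joint: "map_pmf (\<lambda>\<omega>. (A \<omega>, B \<omega>)) p = bind_pmf m (\<lambda>b. map_pmf (\<lambda>a. (a, b)) (k b))"
    and fin: "finite (set_pmf m)"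
  shows "cond_entropy_pmf p A B = measure_pmf.expectation m (\<lambda>b. shannon (k b))"
proof -
  have "map_pmf snd (map_pmf (\<lambda>\<omega>. (A \<omega>, B \<omega>)) p) = m"
    unfolding joint by (simp add: map_bind_pmf pmf.map_comp o_def bind_return_pmf')
  then have B: "map_pmf B p = m" by (simp add: pmf.map_comp o_def)
  have mass: "pmf (bind_pmf m (\<lambda>b. map_pmf (\<lambda>a. (a, b)) (k b))) (a, b) = pmf m b * pmf (k b) a" for a b
  proof -
    have "pmf (map_pmf (\<lambda>a. (a, b')) (k b')) (a, b) = indicator {b} b' * pmf (k b) a" for b'
    proof (cases "b' = b")
      case True
      then show ?thesis by (simp add: pmf_map_inj'[of "\<lambda>a. (a, b)"] inj_on_def)
    qed (auto simp: pmf_eq_0_set_pmf)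
    then show ?thesis
      by (simp add: pmf_bind measure_pmf_single)
  qed
  have "cond_entropy_pmf p A B
      = - measure_pmf.expectation m (\<lambda>b. \<Sum>a\<in>UNIV. pmf (k b) a * ln (pmf m b * pmf (k b) a / pmf m b))"
    unfolding cond_entropy_pmf_eq joint B
    by (simp add: expectation_bind_finite fin expectation_UNIV mass)
  also have "\<dots> = measure_pmf.expectation m (\<lambda>b. - (\<Sum>a\<in>UNIV. pmf (k b) a * ln (pmf m b * pmf (k b) a / pmf m b)))"
    by simp
  also have "\<dots> = measure_pmf.expectation m (\<lambda>b. shannon (k b))"
    by (rule integral_cong_AE) (auto simp: AE_measure_pmf_iff shannon_def pmf_eq_0_set_pmf)
  finally show ?thesis .
qed

lemma evaluation_stagewise:
  "evaluation P R G b1 b2 \<mu> N \<sigma> \<tau> =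
     (\<Sum>n<N. measure_pmf.expectation (hist_law P \<mu> \<sigma> \<tau> n)
        (\<lambda>h. mixed_payoff b1 b2 (R (snd h)) (\<sigma> h) (\<tau> h)))
   + measure_pmf.expectation (hist_law P \<mu> \<sigma> \<tau> N) (\<lambda>h. G (snd h))"
proof -
  define E :: "nat \<Rightarrow> (('a, 'b, 'c) hist \<Rightarrow> real) \<Rightarrow> real"
    where "E n = measure_pmf.expectation (hist_law P \<mu> \<sigma> \<tau> n)" for n
  have payoff: "E N (\<lambda>h. R (state_at (Suc n) h) (action1_at (Suc n) h) (action2_at (Suc n) h))
      = E n (\<lambda>h. \<Sum>u\<in>UNIV. \<Sum>w\<in>UNIV. pmf (\<sigma> h) u * pmf (\<tau> h) w * R (snd h) u w)" if "n < N" for n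
  proof -
    have "E N (\<lambda>h. R (state_at (Suc n) h) (action1_at (Suc n) h) (action2_at (Suc n) h))
      = measure_pmf.expectation (map_pmf (\<lambda>h. (action1_at (Suc n) h, action2_at (Suc n) h, hist_at (Suc n) h))
          (hist_law P \<mu> \<sigma> \<tau> N)) (\<lambda>(u, w, h). R (snd h) u w)"
      by (simp add: E_def hist_at_def)
    also have "\<dots> = E n (\<lambda>h. \<Sum>u\<in>UNIV. \<Sum>w\<in>UNIV. pmf (\<sigma> h) u * pmf (\<tau> h) w * R (snd h) u w)"
      unfolding law_stage[OF that]
      by (simp add: E_def expectation_bind_finite finite_set_hist_law expectation_UNIV
          sum_distrib_left mult.assoc)
    finally show ?thesis .
  qed
  have entropy1: "cond_entropy_pmf (hist_law P \<mu> \<sigma> \<tau> N) (action1_at (Suc n)) (hist_at (Suc n))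
      = E n (\<lambda>h. shannon (\<sigma> h))" if "n < N" for n
    unfolding E_def
  proof (rule cond_entropy_kernel[OF _ finite_set_hist_law])
    show "map_pmf (\<lambda>h. (action1_at (Suc n) h, hist_at (Suc n) h)) (hist_law P \<mu> \<sigma> \<tau> N)
        = bind_pmf (hist_law P \<mu> \<sigma> \<tau> n) (\<lambda>h. map_pmf (\<lambda>u. (u, h)) (\<sigma> h))"
      using arg_cong[OF law_stage[OF that, of P \<mu> \<sigma> \<tau>], of "map_pmf (\<lambda>(u, w, h). (u, h))"]
      by (simp add: map_bind_pmf pmf.map_comp o_def) (simp add: map_pmf_def)
  qed
  have entropy2: "cond_entropy_pmf (hist_law P \<mu> \<sigma> \<tau> N) (action2_at (Suc n)) (hist_at (Suc n))
      = E n (\<lambda>h. shannon (\<tau> h))" if "n < N" for n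
    unfolding E_def
  proof (rule cond_entropy_kernel[OF _ finite_set_hist_law])
    show "map_pmf (\<lambda>h. (action2_at (Suc n) h, hist_at (Suc n) h)) (hist_law P \<mu> \<sigma> \<tau> N)
        = bind_pmf (hist_law P \<mu> \<sigma> \<tau> n) (\<lambda>h. map_pmf (\<lambda>w. (w, h)) (\<tau> h))"
      using arg_cong[OF law_stage[OF that, of P \<mu> \<sigma> \<tau>], of "map_pmf (\<lambda>(u, w, h). (w, h))"]
      by (simp add: map_bind_pmf pmf.map_comp o_def)
  qed
  have terminal: "E N (\<lambda>h. G (state_at (Suc N) h)) = E N (\<lambda>h. G (snd h))"
    unfolding E_def
    by (rule integral_cong_AE) (auto simp: AE_measure_pmf_iff state_at_def dest: length_hist_law)
  have stage: "E n (\<lambda>h. mixed_payoff b1 b2 (R (snd h)) (\<sigma> h) (\<tau> h))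
     = E N (\<lambda>h. R (state_at (Suc n) h) (action1_at (Suc n) h) (action2_at (Suc n) h))
     + 1 / b1 * cond_entropy_pmf (hist_law P \<mu> \<sigma> \<tau> N) (action1_at (Suc n)) (hist_at (Suc n))
     - 1 / b2 * cond_entropy_pmf (hist_law P \<mu> \<sigma> \<tau> N) (action2_at (Suc n)) (hist_at (Suc n))" if "n < N" for n
    unfolding payoff[OF that] entropy1[OF that] entropy2[OF that]
    by (simp add: E_def mixed_payoff_def)
  have "(\<Sum>n<N. E n (\<lambda>h. mixed_payoff b1 b2 (R (snd h)) (\<sigma> h) (\<tau> h))) + E N (\<lambda>h. G (snd h))
      = evaluation P R G b1 b2 \<mu> N \<sigma> \<tau>"
    by (simp add: evaluation_def Let_def E_def[symmetric] terminal stage sum.distrib sum_subtractf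
        sum_divide_distrib sum.atLeast1_atMost_eq lessThan_atLeast0)
  then show ?thesis by (simp add: E_def)
qed

section \<open>Dynamic programming\<close>

text \<open>
  The payoff matrix of the stage game at \<open>h\<close> when reaching a history \<open>h'\<close> after the stage is worth
  \<open>V h'\<close>.
\<close>

definition lookahead ::
  "('x::finite \<Rightarrow> 'u \<Rightarrow> 'w \<Rightarrow> 'x pmf) \<Rightarrow> ('x \<Rightarrow> 'u \<Rightarrow> 'w \<Rightarrow> real) \<Rightarrow>
   (('x, 'u, 'w) hist \<Rightarrow> real) \<Rightarrow> ('x, 'u, 'w) hist \<Rightarrow> 'u \<Rightarrow> 'w \<Rightarrow> real" where
  "lookahead P R V h u w =
     R (snd h) u w + (\<Sum>x\<in>UNIV. pmf (P (snd h) u w) x * V (extend h u w x))"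

text \<open>
  Replacing the stage matrix \<open>R\<close> by \<open>lookahead\<close> adds to the expected payoff of a stage the
  expectation of \<open>V\<close> at the next history.  Subtracting the expectation of \<open>V\<close> at the current one
  leaves increments that telescope to the terminal payoff minus the expected initial value.
  The function \<open>V\<close> is arbitrary before the end of the game, so that one computed from a particular
  pair of strategies can serve to judge every deviation from that pair.
\<close>

lemma evaluation_telescope:
  assumes terminal: "\<And>h. length (fst h) = N \<Longrightarrow> V h = G (snd h)"
  shows "evaluation P R G b1 b2 \<mu> N \<sigma> \<tau> = measure_pmf.expectation \<mu> (\<lambda>x. V ([], x)) +
    (\<Sum>n<N. measure_pmf.expectation (hist_law P \<mu> \<sigma> \<tau> n)
       (\<lambda>h. mixed_payoff b1 b2 (lookahead P R V h) (\<sigma> h) (\<tau> h) - V h))"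
proof -
  define E :: "nat \<Rightarrow> (('a, 'b, 'c) hist \<Rightarrow> real) \<Rightarrow> real"
    where "E n = measure_pmf.expectation (hist_law P \<mu> \<sigma> \<tau> n)" for n
  define r where "r h = mixed_payoff b1 b2 (R (snd h)) (\<sigma> h) (\<tau> h)" for h
  have "mixed_payoff b1 b2 (lookahead P R V h) (\<sigma> h) (\<tau> h) = r h +
      (\<Sum>u\<in>UNIV. \<Sum>w\<in>UNIV. pmf (\<sigma> h) u * pmf (\<tau> h) w *
        (\<Sum>x\<in>UNIV. pmf (P (snd h) u w) x * V (extend h u w x)))" for h
    by (simp add: r_def mixed_payoff_def lookahead_def distrib_left sum.distrib)
  then have "E n (\<lambda>h. mixed_payoff b1 b2 (lookahead P R V h) (\<sigma> h) (\<tau> h) - V h)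
      = E n r + (E (Suc n) V - E n V)" for n
    by (simp add: E_def expectation_hist_law_Suc del: hist_law.simps)
  then have "(\<Sum>n<N. E n (\<lambda>h. mixed_payoff b1 b2 (lookahead P R V h) (\<sigma> h) (\<tau> h) - V h))
      = (\<Sum>n<N. E n r) + (E N V - E 0 V)"
    by (simp add: sum.distrib sum_lessThan_telescope[of "\<lambda>n. E n V"])
  moreover have "E 0 V = measure_pmf.expectation \<mu> (\<lambda>x. V ([], x))"
    by (simp add: E_def)
  moreover have "E N V = E N (\<lambda>h. G (snd h))"
    unfolding E_def
    by (rule integral_cong_AE) (auto simp: AE_measure_pmf_iff dest!: length_hist_law intro: terminal)
  ultimately show ?thesis
    by (simp add: evaluation_stagewise E_def r_def[abs_def])
qed

text \<open>
  Comparison principle: a subsolution of the dynamic programming equation for the pair of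
  strategies has nonnegative one-stage gains, and the evaluation exceeds the expected initial value
  by the sum of their expectations.
\<close>

lemma evaluation_ge:
  assumes "\<And>h. length (fst h) = N \<Longrightarrow> V h = G (snd h)"
    and "\<And>h. length (fst h) < N \<Longrightarrow> V h \<le> mixed_payoff b1 b2 (lookahead P R V h) (\<sigma> h) (\<tau> h)"
  shows "measure_pmf.expectation \<mu> (\<lambda>x. V ([], x)) \<le> evaluation P R G b1 b2 \<mu> N \<sigma> \<tau>"
proof -
  have "0 \<le> (\<Sum>n<N. measure_pmf.expectation (hist_law P \<mu> \<sigma> \<tau> n)
       (\<lambda>h. mixed_payoff b1 b2 (lookahead P R V h) (\<sigma> h) (\<tau> h) - V h))"
    by (intro sum_nonneg measure_pmf.integral_ge_const integrable_hist_law)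
       (simp add: AE_measure_pmf_iff length_hist_law assms(2))
  then show ?thesis
    using evaluation_telescope[where V = V and G = G and N = N, OF assms(1)] by simp
qed

lemma evaluation_le:
  assumes "\<And>h. length (fst h) = N \<Longrightarrow> V h = G (snd h)"
    and "\<And>h. length (fst h) < N \<Longrightarrow> mixed_payoff b1 b2 (lookahead P R V h) (\<sigma> h) (\<tau> h) \<le> V h"
  shows "evaluation P R G b1 b2 \<mu> N \<sigma> \<tau> \<le> measure_pmf.expectation \<mu> (\<lambda>x. V ([], x))"
proof -
  have "(\<Sum>n<N. measure_pmf.expectation (hist_law P \<mu> \<sigma> \<tau> n)
       (\<lambda>h. mixed_payoff b1 b2 (lookahead P R V h) (\<sigma> h) (\<tau> h) - V h)) \<le> 0"
    by (intro sum_nonpos measure_pmf.integral_le_const integrable_hist_law)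
       (simp add: AE_measure_pmf_iff length_hist_law assms(2))
  then show ?thesis
    using evaluation_telescope[where V = V and G = G and N = N, OF assms(1)] by simp
qed

text \<open>
  Saddle points and best replies to a given strategy come from the same recursion and only differ
  in the rule for choosing the two mixed actions at a history.  The rule \<open>Q\<close> is therefore a parameter:
  \<open>Q h a p q\<close> admits the pair \<open>p\<close>, \<open>q\<close> at history \<open>h\<close> when the stage matrix there is \<open>a\<close>.
\<close>

lemma backward_induction:
  fixes P :: "'x::finite \<Rightarrow> 'u::finite \<Rightarrow> 'w::finite \<Rightarrow> 'x pmf"
  assumes solvable: "\<And>h a. \<exists>p q. Q h a p q"
  obtains V \<sigma> \<tau> where
    "\<And>h. length (fst h) = N \<Longrightarrow> V h = G (snd h)"
    "\<And>h. length (fst h) < N \<Longrightarrow> V h = mixed_payoff b1 b2 (lookahead P R V h) (\<sigma> h) (\<tau> h)"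
    "\<And>h. Q h (lookahead P R V h) (\<sigma> h) (\<tau> h)"
proof -
  obtain S T where ST: "\<And>h a. Q h a (S h a) (T h a)" using solvable by metis
  \<comment> \<open>\<open>W k h\<close> is the value of \<open>h\<close> with \<open>k\<close> stages left; \<open>V\<close> reads \<open>k\<close> off the length of the history.\<close>
  define W where "W = rec_nat (\<lambda>h. G (snd h)) (\<lambda>_ f h.
      mixed_payoff b1 b2 (lookahead P R f h) (S h (lookahead P R f h)) (T h (lookahead P R f h)))"
  define V where "V h = W (N - length (fst h)) h" for h
  have look: "lookahead P R V h = lookahead P R (W (N - Suc (length (fst h)))) h" for h
    by (simp add: lookahead_def fun_eq_iff V_def)
  show thesis
  proof (rule that[of V "\<lambda>h. S h (lookahead P R V h)" "\<lambda>h. T h (lookahead P R V h)"])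
    show "V h = G (snd h)" if "length (fst h) = N" for h
      using that by (simp add: V_def W_def)
    show "V h = mixed_payoff b1 b2 (lookahead P R V h) (S h (lookahead P R V h)) (T h (lookahead P R V h))"
      if "length (fst h) < N" for h
      unfolding look unfolding V_def Suc_diff_Suc[OF that, symmetric] by (simp add: W_def)
  qed (rule ST)
qed

section \<open>Saddle points and optimal replies in the game with \<open>N\<close> stages\<close>

text \<open>
  Against \<open>\<sigma>0\<close>, no mixed action of player 2 at any history does better than the one of \<open>\<tau>0\<close>, so \<open>V\<close> is
  a subsolution for \<open>\<sigma>0\<close> paired with any \<open>\<tau>\<close>; symmetrically it is a supersolution for any \<open>\<sigma>\<close>
  paired with \<open>\<tau>0\<close>.
\<close>

lemma saddle_point_exists:
  assumes "b1 > 0" and "b2 > 0"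
  shows "\<exists>\<sigma>0 \<tau>0 v. (\<forall>\<tau>. v \<le> evaluation P R G b1 b2 \<mu> N \<sigma>0 \<tau>) \<and>
    (\<forall>\<sigma>. evaluation P R G b1 b2 \<mu> N \<sigma> \<tau>0 \<le> v)"
proof (rule backward_induction[where Q = "\<lambda>h a p q. p = reply1 b1 a q \<and> q = reply2 b2 a p"])
  show "\<exists>p q. p = reply1 b1 a q \<and> q = reply2 b2 a p" for a :: "'b \<Rightarrow> 'c \<Rightarrow> real"
    by (rule mutual_replies_exist[of b1 a b2]) blast
next
  fix V \<sigma>0 \<tau>0
  assume terminal: "\<And>h. length (fst h) = N \<Longrightarrow> V h = G (snd h)"
    and bellman: "\<And>h. length (fst h) < N \<Longrightarrow> V h = mixed_payoff b1 b2 (lookahead P R V h) (\<sigma>0 h) (\<tau>0 h)"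
    and replies: "\<And>h. \<sigma>0 h = reply1 b1 (lookahead P R V h) (\<tau>0 h) \<and>
      \<tau>0 h = reply2 b2 (lookahead P R V h) (\<sigma>0 h)"
  have "measure_pmf.expectation \<mu> (\<lambda>x. V ([], x)) \<le> evaluation P R G b1 b2 \<mu> N \<sigma>0 \<tau>" for \<tau>
  proof (rule evaluation_ge)
    show "V h \<le> mixed_payoff b1 b2 (lookahead P R V h) (\<sigma>0 h) (\<tau> h)" if "length (fst h) < N" for h
      using reply2_best[OF assms(2), of b1 "lookahead P R V h" "\<sigma>0 h" "\<tau> h"]
      unfolding bellman[OF that] conjunct2[OF replies, symmetric] .
  qed (rule terminal)
  moreover have "evaluation P R G b1 b2 \<mu> N \<sigma> \<tau>0 \<le> measure_pmf.expectation \<mu> (\<lambda>x. V ([], x))" for \<sigma>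
  proof (rule evaluation_le)
    show "mixed_payoff b1 b2 (lookahead P R V h) (\<sigma> h) (\<tau>0 h) \<le> V h" if "length (fst h) < N" for h
      using reply1_best[OF assms(1), of b2 "lookahead P R V h" "\<sigma> h" "\<tau>0 h"]
      unfolding bellman[OF that] conjunct1[OF replies, symmetric] .
  qed (rule terminal)
  ultimately show ?thesis by blast
qed

text \<open>
  Fixing \<open>\<sigma>\<close> leaves a one-player problem, whose minimum is attained by the Gibbs reply to the
  continuation values.  Since \<open>\<sigma>\<close> may depend on the past, so does \<open>V\<close>, which is why values are
  attached to histories and not to states.
\<close>

lemma minimizing_reply_exists:
  assumes "b2 > 0"
  shows "\<exists>v. is_minimum (\<lambda>\<tau>. evaluation P R G b1 b2 \<mu> N \<sigma> \<tau>) v"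
proof (rule backward_induction[where Q = "\<lambda>h a p q. p = \<sigma> h \<and> q = reply2 b2 a (\<sigma> h)"])
  fix V \<sigma>' \<tau>0
  assume terminal: "\<And>h. length (fst h) = N \<Longrightarrow> V h = G (snd h)"
    and "\<And>h. length (fst h) < N \<Longrightarrow> V h = mixed_payoff b1 b2 (lookahead P R V h) (\<sigma>' h) (\<tau>0 h)"
    and reply: "\<And>h. \<sigma>' h = \<sigma> h \<and> \<tau>0 h = reply2 b2 (lookahead P R V h) (\<sigma> h)"
  then have bellman:
    "\<And>h. length (fst h) < N \<Longrightarrow> V h = mixed_payoff b1 b2 (lookahead P R V h) (\<sigma> h) (\<tau>0 h)"
    by simp
  let ?v = "measure_pmf.expectation \<mu> (\<lambda>x. V ([], x))"
  have "?v \<le> evaluation P R G b1 b2 \<mu> N \<sigma> \<tau>" for \<tau>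
  proof (rule evaluation_ge)
    show "V h \<le> mixed_payoff b1 b2 (lookahead P R V h) (\<sigma> h) (\<tau> h)" if "length (fst h) < N" for h
      using reply2_best[OF assms, of b1 "lookahead P R V h" "\<sigma> h" "\<tau> h"]
      unfolding bellman[OF that] conjunct2[OF reply, symmetric] .
  qed (rule terminal)
  moreover have "evaluation P R G b1 b2 \<mu> N \<sigma> \<tau>0 \<le> ?v"
    by (rule evaluation_le) (simp_all only: terminal bellman[symmetric] order_refl)
  ultimately have "is_minimum (\<lambda>\<tau>. evaluation P R G b1 b2 \<mu> N \<sigma> \<tau>) ?v"
    unfolding is_minimum_def by (metis order_antisym rangeI)
  then show ?thesis ..
qed blast

lemma maximizing_reply_exists:
  assumes "b1 > 0"
  shows "\<exists>v. is_maximum (\<lambda>\<sigma>. evaluation P R G b1 b2 \<mu> N \<sigma> \<tau>) v"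
proof (rule backward_induction[where Q = "\<lambda>h a p q. p = reply1 b1 a (\<tau> h) \<and> q = \<tau> h"])
  fix V \<sigma>0 \<tau>'
  assume terminal: "\<And>h. length (fst h) = N \<Longrightarrow> V h = G (snd h)"
    and "\<And>h. length (fst h) < N \<Longrightarrow> V h = mixed_payoff b1 b2 (lookahead P R V h) (\<sigma>0 h) (\<tau>' h)"
    and reply: "\<And>h. \<sigma>0 h = reply1 b1 (lookahead P R V h) (\<tau> h) \<and> \<tau>' h = \<tau> h"
  then have bellman:
    "\<And>h. length (fst h) < N \<Longrightarrow> V h = mixed_payoff b1 b2 (lookahead P R V h) (\<sigma>0 h) (\<tau> h)"
    by simp
  let ?v = "measure_pmf.expectation \<mu> (\<lambda>x. V ([], x))"
  have "evaluation P R G b1 b2 \<mu> N \<sigma> \<tau> \<le> ?v" for \<sigma>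
  proof (rule evaluation_le)
    show "mixed_payoff b1 b2 (lookahead P R V h) (\<sigma> h) (\<tau> h) \<le> V h" if "length (fst h) < N" for h
      using reply1_best[OF assms, of b2 "lookahead P R V h" "\<sigma> h" "\<tau> h"]
      unfolding bellman[OF that] conjunct1[OF reply, symmetric] .
  qed (rule terminal)
  moreover have "?v \<le> evaluation P R G b1 b2 \<mu> N \<sigma>0 \<tau>"
    by (rule evaluation_ge) (simp_all only: terminal bellman[symmetric] order_refl)
  ultimately have "is_maximum (\<lambda>\<sigma>. evaluation P R G b1 b2 \<mu> N \<sigma> \<tau>) ?v"
    unfolding is_maximum_def by (metis order_antisym rangeI)
  then show ?thesis ..
qed blast

theorem theorem1:
  fixes P :: "'x::finite \<Rightarrow> 'u::finite \<Rightarrow> 'w::finite \<Rightarrow> 'x pmf"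
    and R :: "'x \<Rightarrow> 'u \<Rightarrow> 'w \<Rightarrow> real"
    and G :: "'x \<Rightarrow> real"
    and \<beta>1 \<beta>2 :: real
    and \<mu> :: "'x pmf"
    and N :: nat
  assumes "N \<ge> 1" and "\<beta>1 > 0" and "\<beta>2 > 0"
  shows "\<exists>(lower :: ('x, 'u, 'w) strategy1 \<Rightarrow> real) (upper :: ('x, 'u, 'w) strategy2 \<Rightarrow> real) v.
    (\<forall>\<sigma>. is_minimum (\<lambda>\<tau>. evaluation P R G \<beta>1 \<beta>2 \<mu> N \<sigma> \<tau>) (lower \<sigma>)) \<and> is_maximum lower v \<and>
    (\<forall>\<tau>. is_maximum (\<lambda>\<sigma>. evaluation P R G \<beta>1 \<beta>2 \<mu> N \<sigma> \<tau>) (upper \<tau>)) \<and> is_minimum upper v"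
proof -
  let ?\<Phi> = "evaluation P R G \<beta>1 \<beta>2 \<mu> N"
  have "\<forall>\<sigma>. \<exists>v. is_minimum (\<lambda>\<tau>. ?\<Phi> \<sigma> \<tau>) v"
    by (intro allI minimizing_reply_exists \<open>\<beta>2 > 0\<close>)
  then obtain lower where lower: "\<And>\<sigma>. is_minimum (\<lambda>\<tau>. ?\<Phi> \<sigma> \<tau>) (lower \<sigma>)"
    by metis
  have "\<forall>\<tau>. \<exists>v. is_maximum (\<lambda>\<sigma>. ?\<Phi> \<sigma> \<tau>) v"
    by (intro allI maximizing_reply_exists \<open>\<beta>1 > 0\<close>)
  then obtain upper where upper: "\<And>\<tau>. is_maximum (\<lambda>\<sigma>. ?\<Phi> \<sigma> \<tau>) (upper \<tau>)"
    by metis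
  obtain \<sigma>0 \<tau>0 v where saddle: "\<And>\<tau>. v \<le> ?\<Phi> \<sigma>0 \<tau>" "\<And>\<sigma>. ?\<Phi> \<sigma> \<tau>0 \<le> v"
    using saddle_point_exists[OF \<open>\<beta>1 > 0\<close> \<open>\<beta>2 > 0\<close>, of P R G \<mu> N] by blast
  have "v \<le> lower \<sigma>0"
    using lower[of \<sigma>0] saddle(1) by (auto simp: is_minimum_def)
  moreover have "lower \<sigma> \<le> v" for \<sigma>
    using lower[of \<sigma>] saddle(2)[of \<sigma>] unfolding is_minimum_def by (meson order_trans)
  ultimately have "is_maximum lower v"
    unfolding is_maximum_def by (metis order_antisym rangeI)
  have "upper \<tau>0 \<le> v"
    using upper[of \<tau>0] saddle(2) by (auto simp: is_maximum_def)
  moreover have "v \<le> upper \<tau>" for \<tau>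
    using upper[of \<tau>] saddle(1)[of \<tau>] unfolding is_maximum_def by (meson order_trans)
  ultimately have "is_minimum upper v"
    unfolding is_minimum_def by (metis order_antisym rangeI)
  with \<open>is_maximum lower v\<close> show ?thesis
    using lower upper by blast
qed

end
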